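(* Let $0<\gamma<n$, let $u\in A_1$ be a weight on $\mathbb{R}^n$, let $v(x)=|x|^\beta$ with $\beta<-n$, and let $q=n/(n-\gamma)$. Then there exists a positive constant $C$ such that the inequality \[uv^q\left(\left\{x\in\mathbb{R}^n: \frac{|I_\gamma(fv)(x)|}{v(x)}>t\right\}\right)^{1/q}\leq \frac{C}{t}\int_{\mathbb{R}^n}|f(x)|\,u^{1/q}(x)\,v(x)\,dx\] holds for every $t>0$ and every bounded (measurable) function $f$ on $\mathbb{R}^n$.
   Context: A weight is a locally integrable function $w$ on $\mathbb{R}^n$ with $0<w(x)<\infty$ for almost every $x$. For a nonnegative measurable function $w$ and a measurable set $E$, $w(E)=\int_E w(x)\,dx$; thus $uv^q(E)=\int_E u(x)v(x)^q\,dx$. Cubes have sides parallel to the coordinate axes. A weight $w$ belongs to $A_1$ if there is a constant $C>0$ with $\frac1{|Q|}\int_Q w\leq C\inf_Q w$ (essential infimum) for every cube $Q\subseteq\mathbb{R}^n$. The fractional integral operator is $I_\gamma g(x)=\int_{\mathbb{R}^n}\frac{g(y)}{|x-y|^{n-\gamma}}\,dy$, defined for every $g$ such that the integral is finite for almost every $x$. *)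

theory Defs
  imports "HOL-Analysis.Analysis"
begin

text \<open>The absolute-value function on \<open>\<real>\<^sup>n\<close> is the Euclidean norm of \<^typ>\<open>real^'n\<close>, and
  \<open>n\<close> is \<open>CARD('n)\<close>. Measurability and integrals refer to Lebesgue measure.\<close>

definition locally_integrable :: "(real^'n \<Rightarrow> real) \<Rightarrow> bool" where
  "locally_integrable w \<longleftrightarrow> (\<forall>K. compact K \<longrightarrow> set_integrable lebesgue K w)"

text \<open>Finiteness of a weight is part of its type; positivity is only required almost everywhere.\<close>

definition weight :: "(real^'n \<Rightarrow> real) \<Rightarrow> bool" where
  "weight w \<longleftrightarrow> locally_integrable w \<and> (AE x in lebesgue. 0 < w x)"

definition wmeasure :: "(real^'n \<Rightarrow> real) \<Rightarrow> (real^'n) set \<Rightarrow> ennreal" where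
  "wmeasure w E = (\<integral>\<^sup>+x\<in>E. ennreal (w x) \<partial>lebesgue)"

definition cube :: "(real^'n) set \<Rightarrow> bool" where
  "cube Q \<longleftrightarrow> (\<exists>a l. 0 < l \<and> Q = cbox a (\<chi> i. a $ i + l))"

definition essinf_on :: "(real^'n) set \<Rightarrow> (real^'n \<Rightarrow> real) \<Rightarrow> ennreal" where
  "essinf_on Q w = Sup {c. AE x in lebesgue. x \<in> Q \<longrightarrow> c \<le> ennreal (w x)}"

definition A1 :: "(real^'n \<Rightarrow> real) \<Rightarrow> bool" where
  "A1 w \<longleftrightarrow> weight w \<and>
     (\<exists>C::real. \<forall>Q. cube Q \<longrightarrow> wmeasure w Q / emeasure lebesgue Q \<le> ennreal C * essinf_on Q w)"

text \<open>As usual for the Bochner integral, the value is \<open>0\<close> at points where the integrand is not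
  absolutely integrable. The integrand is \<open>0\<close> at \<open>y = x\<close>, which does not affect the integral.\<close>

definition frac_integral :: "real \<Rightarrow> (real^'n \<Rightarrow> real) \<Rightarrow> real^'n \<Rightarrow> real" where
  "frac_integral \<gamma> g x = (LINT y|lebesgue. g y / norm (x - y) powr (real CARD('n) - \<gamma>))"

text \<open>Real powers of extended nonnegative numbers, for positive exponents only.\<close>

definition ennpowr :: "ennreal \<Rightarrow> real \<Rightarrow> ennreal" where
  "ennpowr a p = (if a = \<infinity> then \<infinity> else ennreal (enn2real a powr p))"

end

theory Submission
  imports Defs
begin

text \<open>For \<open>q > 1\<close> the weak \<open>L\<^sup>q\<close> quasinorm is equivalent to a norm, so by a Minkowski-type argument
  it suffices to treat point masses, that is, to show
  \<open>uv\<^sup>q({x. |x - y|\<^sup>\<gamma>\<^sup>-\<^sup>n / v(x) > s}) \<le> A s\<^sup>-\<^sup>q u(y)\<close> for almost every \<open>y\<close> and all \<open>s > 0\<close>.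
  With \<open>b = -\<beta>/(n - \<gamma>) > 1\<close> and \<open>r = s\<^sup>-\<^sup>1\<^sup>/\<^sup>(\<^sup>n\<^sup>-\<^sup>\<gamma>\<^sup>)\<close> the set is \<open>{x. |x - y| < r|x|\<^sup>b}\<close> and
  \<open>v\<^sup>q = |x|\<^sup>-\<^sup>b\<^sup>n\<close>, and the estimate only uses the \<open>A\<^sub>1\<close> consequence
  \<open>u(B(y, R)) \<le> B R\<^sup>n u(y)\<close>.\<close>

section \<open>Upper bounds by covers, dyadic scales and geometric series\<close>

text \<open>The sets \<open>T k\<close> may overlap: at each point where \<open>h\<close> does not
  vanish, a single term of the sum already dominates \<open>h\<close>, and the other terms only add
  to it. This allows dyadic decompositions with full level sets or full balls in place of disjoint
  shells, and without measurability of \<open>h\<close>.\<close>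

lemma nn_integral_le_suminf_cover:
  fixes h :: "'a \<Rightarrow> ennreal" and c :: "nat \<Rightarrow> ennreal"
  assumes T: "\<And>k. T k \<in> sets M"
    and cover: "\<And>x. x \<in> space M \<Longrightarrow> h x \<noteq> 0 \<Longrightarrow> \<exists>k. x \<in> T k \<and> h x \<le> c k"
  shows "(\<integral>\<^sup>+x. h x \<partial>M) \<le> (\<Sum>k. c k * emeasure M (T k))"
proof -
  have "(\<integral>\<^sup>+x. h x \<partial>M) \<le> (\<integral>\<^sup>+x. (\<Sum>k. c k * indicator (T k) x) \<partial>M)"
  proof (rule nn_integral_mono)
    fix x assume x: "x \<in> space M"
    show "h x \<le> (\<Sum>k. c k * indicator (T k) x)"
    proof (cases "h x = 0")
      case False
      then obtain k where k: "x \<in> T k" "h x \<le> c k"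
        using cover x by blast
      then have "h x \<le> c k * indicator (T k) x"
        by simp
      also have "\<dots> = (\<Sum>j\<in>{k}. c j * indicator (T j) x)"
        by (subst sum.insert) simp_all
      also have "\<dots> \<le> (\<Sum>k. c k * indicator (T k) x)"
        by (rule sum_le_suminf) auto
      finally show ?thesis .
    qed simp
  qed
  also have "\<dots> = (\<Sum>k. \<integral>\<^sup>+x. c k * indicator (T k) x \<partial>M)"
    by (intro nn_integral_suminf borel_measurable_times_ennreal borel_measurable_const
        borel_measurable_indicator T)
  also have "\<dots> = (\<Sum>k. c k * emeasure M (T k))"
    using T by (simp add: nn_integral_cmult_indicator)
  finally show ?thesis .
qed

lemma nn_integral_le_cmult_emeasure:
  assumes "T \<in> sets M" and "\<And>x. h x \<le> c * indicator T x" and "emeasure M T \<le> m"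
  shows "(\<integral>\<^sup>+x. h x \<partial>M) \<le> c * m"
proof -
  have "(\<integral>\<^sup>+x. h x \<partial>M) \<le> (\<integral>\<^sup>+x. c * indicator T x \<partial>M)"
    by (intro nn_integral_mono assms)
  also have "\<dots> = c * emeasure M T"
    using assms by (simp add: nn_integral_cmult_indicator)
  also have "\<dots> \<le> c * m"
    by (intro mult_left_mono assms) simp
  finally show ?thesis .
qed

lemma dyadic_scale:
  fixes a x :: real
  assumes "0 < a" "a < x"
  obtains k :: nat where "2 ^ k * a < x" "x \<le> 2 ^ Suc k * a"
proof -
  obtain j :: nat where j: "x / a < 2 ^ j"
    using real_arch_pow[of 2 "x / a"] by auto
  then have ex: "x \<le> 2 ^ j * a"
    using assms by (simp add: field_simps)
  define k where "k = (LEAST j. x \<le> 2 ^ j * a)"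
  have k: "x \<le> 2 ^ k * a"
    unfolding k_def using ex by (rule LeastI)
  \<comment> \<open>The least exponent is not 0 because \<open>a < x\<close>, so it has a
    predecessor, at which the upper bound fails.\<close>
  obtain l where l: "k = Suc l"
    using k assms by (cases k) auto
  have "\<not> x \<le> 2 ^ l * a"
    using not_less_Least[of l "\<lambda>j. x \<le> 2 ^ j * a"] l k_def by simp
  then show ?thesis
    using that[of l] k l by simp
qed

lemma two_power_powr: "(2 ^ k :: real) powr p = (2 powr p) ^ k"
proof -
  have "(2 ^ k :: real) = 2 powr real k"
    by (simp add: powr_realpow)
  then show ?thesis
    by (simp add: powr_powr powr_power mult.commute)
qed

lemma suminf_ennreal_geometric:
  fixes a \<rho> :: real
  assumes "0 \<le> a" "0 \<le> \<rho>" "\<rho> < 1"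
  shows "(\<Sum>k. ennreal (a * \<rho> ^ k)) = ennreal (a / (1 - \<rho>))"
proof -
  have "(\<lambda>k. a * \<rho> ^ k) sums (a * (1 / (1 - \<rho>)))"
    using assms by (intro sums_mult geometric_sums) auto
  then show ?thesis
    using assms by (intro suminf_ennreal_eq) auto
qed

section \<open>From weak bounds on kernel sections to a weak-type bound for the operator\<close>

text \<open>This is Kolmogorov's inequality, the source of the equivalence of weak
  \<open>L^q\<close> with a normed space. The part of \<open>k\<close> below a height
  \<open>L\<close> contributes at most \<open>L * m\<close>. The part above \<open>L\<close> is
  summed over dyadic levels; level \<open>j\<close> costs at most
  \<open>2 * A * w * (2 ^ j * L) powr (1 - q)\<close>, which is geometric with ratio
  \<open>2 powr (1 - q) < 1\<close> because \<open>q > 1\<close>.\<close>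

lemma set_nn_integral_le_weak_bound:
  fixes k :: "'a \<Rightarrow> real" and q A w m :: real
  assumes k[measurable]: "k \<in> borel_measurable \<mu>"
    and "1 < q" "0 \<le> A" "0 < w" "0 < m"
    and weak: "\<And>s. 0 < s \<Longrightarrow> emeasure \<mu> {x\<in>space \<mu>. s < k x} \<le> ennreal (A * s powr - q * w)"
    and E[measurable]: "E \<in> sets \<mu>" and m: "emeasure \<mu> E = ennreal m"
  shows "(\<integral>\<^sup>+x\<in>E. ennreal (k x) \<partial>\<mu>)
    \<le> ennreal ((1 + 2 * A / (1 - 2 powr (1 - q))) * m powr (1 - 1 / q) * w powr (1 / q))"
proof -
  \<comment> \<open>The height that balances the two parts: both \<open>L * m\<close> and
    \<open>w * L powr (1 - q)\<close> equal \<open>X\<close>.\<close>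
  define L where "L = (w / m) powr (1 / q)"
  have L: "0 < L" 
    using assms by (simp add: L_def)
  define X where "X = m powr (1 - 1 / q) * w powr (1 / q)"
  have Lm: "L * m = X"
    using assms by (simp add: L_def X_def powr_divide powr_diff)
  have "L powr (1 - q) = (w / m) powr (1 / q - 1)"
    using assms by (simp add: L_def powr_powr diff_divide_distrib)
  then have Lw: "w * L powr (1 - q) = X"
    using assms by (simp add: X_def powr_divide powr_diff)
  have rho: "(2::real) powr (1 - q) < 1"
    using \<open>1 < q\<close> powr_less_cancel_iff[of 2 "1 - q" 0] by simp
  have X: "0 \<le> X"
    by (simp add: X_def)
  \<comment> \<open>The tail is taken over the whole space: the weak bound controls entire level
    sets, so no intersection with \<open>E\<close> is needed.\<close>
  have tail: "(\<integral>\<^sup>+x. ennreal (k x) * indicator {x\<in>space \<mu>. L < k x} x \<partial>\<mu>)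
      \<le> (\<Sum>j. ennreal (2 ^ Suc j * L) * emeasure \<mu> {x\<in>space \<mu>. 2 ^ j * L < k x})"
  proof (rule nn_integral_le_suminf_cover)
    fix x assume x: "x \<in> space \<mu>"
      and "ennreal (k x) * indicator {x \<in> space \<mu>. L < k x} x \<noteq> 0"
    then have "L < k x"
      by (auto split: split_indicator_asm)
    then obtain j where "2 ^ j * L < k x" "k x \<le> 2 ^ Suc j * L"
      using dyadic_scale L by blast
    then show "\<exists>j. x \<in> {x\<in>space \<mu>. 2 ^ j * L < k x} \<and>
        ennreal (k x) * indicator {x \<in> space \<mu>. L < k x} x \<le> ennreal (2 ^ Suc j * L)"
      using x \<open>L < k x\<close> by (intro exI[of _ j]) (simp add: ennreal_leI)
  qed measurable
  also have "\<dots> \<le> (\<Sum>j. ennreal (2 * A * X * (2 powr (1 - q)) ^ j))"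
  proof (rule suminf_le)
    fix j
    have "ennreal (2 ^ Suc j * L) * emeasure \<mu> {x\<in>space \<mu>. 2 ^ j * L < k x}
        \<le> ennreal (2 ^ Suc j * L) * ennreal (A * (2 ^ j * L) powr - q * w)"
      using L by (intro mult_left_mono weak) auto
    also have "\<dots> = ennreal (2 * A * ((2 ^ j * L) * (2 ^ j * L) powr - q) * w)"
      using L assms by (simp add: ennreal_mult[symmetric] mult_ac)
    also have "(2 ^ j * L) * (2 ^ j * L) powr - q = (2 ^ j * L) powr (1 - q)"
      using L by (simp add: powr_diff powr_minus divide_inverse)
    also have "\<dots> = (2 powr (1 - q)) ^ j * L powr (1 - q)"
      using L by (simp add: powr_mult two_power_powr)
    also have "2 * A * ((2 powr (1 - q)) ^ j * L powr (1 - q)) * w = 2 * A * X * (2 powr (1 - q)) ^ j"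
      by (simp add: Lw[symmetric] mult_ac)
    finally show "ennreal (2 ^ Suc j * L) * emeasure \<mu> {x\<in>space \<mu>. 2 ^ j * L < k x}
        \<le> ennreal (2 * A * X * (2 powr (1 - q)) ^ j)" .
  qed auto
  also have "\<dots> = ennreal (2 * A * X / (1 - 2 powr (1 - q)))"
    using rho assms X by (intro suminf_ennreal_geometric) auto
  finally have tail: "(\<integral>\<^sup>+x. ennreal (k x) * indicator {x\<in>space \<mu>. L < k x} x \<partial>\<mu>)
      \<le> ennreal (2 * A * X / (1 - 2 powr (1 - q)))" .
  have "(\<integral>\<^sup>+x\<in>E. ennreal (k x) \<partial>\<mu>)
      \<le> (\<integral>\<^sup>+x. ennreal L * indicator E x + ennreal (k x) * indicator {x\<in>space \<mu>. L < k x} x \<partial>\<mu>)"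
    by (intro nn_integral_mono) (auto split: split_indicator intro: ennreal_leI)
  also have "\<dots> = ennreal L * ennreal m
      + (\<integral>\<^sup>+x. ennreal (k x) * indicator {x\<in>space \<mu>. L < k x} x \<partial>\<mu>)"
    by (subst nn_integral_add) (auto simp: nn_integral_cmult_indicator m)
  also have "\<dots> \<le> ennreal X + ennreal (2 * A * X / (1 - 2 powr (1 - q)))"
    using tail L assms by (intro add_mono) (simp_all add: ennreal_mult[symmetric] Lm)
  also have "\<dots> = ennreal ((1 + 2 * A / (1 - 2 powr (1 - q))) * X)"
    using X assms rho by (subst ennreal_plus[symmetric]) (auto simp: algebra_simps)
  finally show ?thesis
    by (simp add: X_def mult_ac)
qed

text \<open>Duality against the indicator of the level set \<open>E\<close> itself. Chebyshev and
  Fubini bound \<open>t * m\<close> by the integral over \<open>y\<close> of \<open>g y\<close>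
  times the integral of \<open>K x y\<close> over \<open>x\<close> in \<open>E\<close>. Kolmogorov's
  inequality for each section turns this into \<open>t * m \<le> c * m powr (1 - 1 / q) * I\<close>,
  and cancelling the power of \<open>m\<close> leaves the claim.\<close>

lemma weak_type_integral_operator:
  fixes K :: "'a \<Rightarrow> 'b \<Rightarrow> real" and g :: "'b \<Rightarrow> ennreal" and w :: "'b \<Rightarrow> real" and q A t I :: real
  assumes "finite_measure \<mu>" "sigma_finite_measure \<nu>"
    and K[measurable]: "(\<lambda>(x, y). K x y) \<in> borel_measurable (\<mu> \<Otimes>\<^sub>M \<nu>)"
    and g[measurable]: "g \<in> borel_measurable \<nu>" and w[measurable]: "w \<in> borel_measurable \<nu>"
    and q: "1 < q" and A: "0 \<le> A" and t: "0 < t" and I: "0 \<le> I"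
    and w_pos: "AE y in \<nu>. 0 < w y"
    and weak: "AE y in \<nu>. \<forall>s>0. emeasure \<mu> {x\<in>space \<mu>. s < K x y} \<le> ennreal (A * s powr - q * w y)"
    and gw: "(\<integral>\<^sup>+y. g y * ennreal (w y powr (1 / q)) \<partial>\<nu>) = ennreal I"
  shows "emeasure \<mu> {x\<in>space \<mu>. ennreal t < (\<integral>\<^sup>+y. g y * ennreal (K x y) \<partial>\<nu>)}
    \<le> ennreal (((1 + 2 * A / (1 - 2 powr (1 - q))) * I / t) powr q)"
proof -
  interpret \<mu>: finite_measure \<mu> by fact
  interpret \<nu>: sigma_finite_measure \<nu> by fact
  interpret P: pair_sigma_finite \<mu> \<nu> ..
  define c where "c = 1 + 2 * A / (1 - 2 powr (1 - q))"
  have "(2::real) powr (1 - q) < 1"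
    using q powr_less_cancel_iff[of 2 "1 - q" 0] by simp
  then have c: "0 < c"
    using A by (simp add: c_def add_pos_nonneg)
  define E where "E = {x\<in>space \<mu>. ennreal t < (\<integral>\<^sup>+y. g y * ennreal (K x y) \<partial>\<nu>)}"
  have E[measurable]: "E \<in> sets \<mu>"
    unfolding E_def by measurable
  define m where "m = measure \<mu> E"
  \<comment> \<open>Finiteness of \<open>\<mu>\<close> makes the measure of \<open>E\<close> a real
    number, which is what permits the cancellation of \<open>m powr (1 - 1 / q)\<close> at the
    end.\<close>
  have em: "emeasure \<mu> E = ennreal m"
    by (simp add: m_def \<mu>.emeasure_eq_measure)
  show ?thesis
  proof (cases "m = 0")
    case True
    then show ?thesis
      using em by (simp add: E_def)
  next
    case False
    then have m: "0 < m"
      by (simp add: m_def zero_less_measure_iff)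
    have "ennreal (t * m) = (\<integral>\<^sup>+x. ennreal t * indicator E x \<partial>\<mu>)"
      using t m by (simp add: nn_integral_cmult_indicator em ennreal_mult)
    also have "\<dots> \<le> (\<integral>\<^sup>+x. (\<integral>\<^sup>+y. g y * (ennreal (K x y) * indicator E x) \<partial>\<nu>) \<partial>\<mu>)"
      by (intro nn_integral_mono) (auto simp: E_def split: split_indicator)
    also have "\<dots> = (\<integral>\<^sup>+y. (\<integral>\<^sup>+x. g y * (ennreal (K x y) * indicator E x) \<partial>\<mu>) \<partial>\<nu>)"
      by (rule P.Fubini'[symmetric]) measurable
    also have "\<dots> = (\<integral>\<^sup>+y. g y * (\<integral>\<^sup>+x\<in>E. ennreal (K x y) \<partial>\<mu>) \<partial>\<nu>)"
      by (intro nn_integral_cong nn_integral_cmult) measurable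
    also have "\<dots> \<le> (\<integral>\<^sup>+y. ennreal (c * m powr (1 - 1 / q)) * (g y * ennreal (w y powr (1 / q))) \<partial>\<nu>)"
    proof (rule nn_integral_mono_AE)
      show "AE y in \<nu>. g y * (\<integral>\<^sup>+x\<in>E. ennreal (K x y) \<partial>\<mu>)
          \<le> ennreal (c * m powr (1 - 1 / q)) * (g y * ennreal (w y powr (1 / q)))"
        using w_pos weak AE_space
      proof eventually_elim
        case (elim y)
        have [measurable]: "(\<lambda>x. K x y) \<in> borel_measurable \<mu>"
          using elim(3) by measurable
        have "(\<integral>\<^sup>+x\<in>E. ennreal (K x y) \<partial>\<mu>) \<le> ennreal (c * m powr (1 - 1 / q) * w y powr (1 / q))"
          unfolding c_def using elim m q A em by (intro set_nn_integral_le_weak_bound) auto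
        also have "\<dots> = ennreal (c * m powr (1 - 1 / q)) * ennreal (w y powr (1 / q))"
          using c by (simp add: ennreal_mult)
        finally show ?case
          by (metis mult.left_commute mult_left_mono zero_le)
      qed
    qed
    also have "\<dots> = ennreal (c * m powr (1 - 1 / q)) * ennreal I"
      by (simp add: nn_integral_cmult gw)
    also have "\<dots> = ennreal (c * m powr (1 - 1 / q) * I)"
      using c I by (simp add: ennreal_mult)
    finally have "t * m \<le> c * m powr (1 - 1 / q) * I"
      using c I by (subst (asm) ennreal_le_iff) auto
    moreover have "m = m powr (1 - 1 / q) * m powr (1 / q)"
      using m by (simp flip: powr_add)
    ultimately have "m powr (1 - 1 / q) * (t * m powr (1 / q)) \<le> m powr (1 - 1 / q) * (c * I)"
      by (simp add: mult_ac)
    then have "t * m powr (1 / q) \<le> c * I"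
      using m by simp
    then have "m powr (1 / q) \<le> c * I / t"
      using t by (simp add: field_simps)
    then have "(m powr (1 / q)) powr q \<le> (c * I / t) powr q"
      using q by (intro powr_mono2) auto
    then have "m \<le> (c * I / t) powr q"
      using m q by (simp add: powr_powr)
    then show ?thesis
      using em by (simp add: E_def c_def ennreal_leI)
  qed
qed

section \<open>The estimate for a point mass with a power weight\<close>

text \<open>Three regions: for \<open>|y|/2 \<le> |x| \<le> 2|y|\<close> the weight is comparable to \<open>|y|\<^sup>-\<^sup>b\<^sup>d\<close> and
  \<open>x\<close> lies in a ball of radius comparable to \<open>r|y|\<^sup>b\<close> about \<open>y\<close>; for smaller \<open>x\<close> we have \<open>|x - y| \<ge> |y|/2\<close>,
  which bounds the weight; for larger \<open>x\<close> we have \<open>|x - y| \<ge> |x|/2\<close>, which forces \<open>|x|\<^sup>b\<^sup>-\<^sup>1 > 1/(2r)\<close>.\<close>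

lemma set_nn_integral_power_weight_le:
  fixes W :: "'a::euclidean_space measure" and b d r D :: real
  assumes sets_W: "sets W = sets lebesgue"
    and growth: "\<And>R. 0 < R \<Longrightarrow> emeasure W (ball y R) \<le> ennreal (D * R powr d)"
    and D: "0 \<le> D" and d: "0 < d" and b: "1 < b" and r: "0 < r" and y: "y \<noteq> 0"
  shows "(\<integral>\<^sup>+x. ennreal (norm x powr - (b * d)) * indicator {x. norm (x - y) < r * norm x powr b} x \<partial>W)
    \<le> ennreal ((4 powr (b * d) + 4 powr d + 8 powr d / (1 - 2 powr - ((b - 1) * d))) * r powr d * D)"
proof -
  have space_W: "space W = UNIV"
    using sets_eq_imp_space_eq[OF sets_W] by simp
  have borel_W: "S \<in> sets W" if "S \<in> sets borel" for S
    using that sets_W by simp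
  have [measurable]: "(\<lambda>x. x) \<in> borel_measurable W"
    using borel_W by (auto simp: measurable_def space_W)
  define Y where "Y = norm y"
  have Y: "0 < Y"
    using y by (simp add: Y_def)
  define S where "S = {x. norm (x - y) < r * norm x powr b}"
  have S[measurable]: "S \<in> sets W"
    unfolding S_def by (intro borel_W) measurable
  define h where "h x = ennreal (norm x powr - (b * d))" for x :: 'a
  have [measurable]: "h \<in> borel_measurable W"
    unfolding h_def by measurable
  define S1 where "S1 = S \<inter> {x. Y / 2 \<le> norm x \<and> norm x \<le> 2 * Y}"
  \<comment> \<open>The origin is left out of all three pieces. Nothing is lost, since
    \<open>0 powr p = 0\<close> gives \<open>h 0 = 0\<close>.\<close>
  define S2 where "S2 = S \<inter> {x. 0 < norm x \<and> norm x < Y / 2}"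
  define S3 where "S3 = S \<inter> {x. 2 * Y < norm x}"
  have [measurable]: "S1 \<in> sets W" "S2 \<in> sets W" "S3 \<in> sets W"
  proof -
    have *: "{x::'a. Y / 2 \<le> norm x \<and> norm x \<le> 2 * Y} \<in> sets borel"
      "{x::'a. 0 < norm x \<and> norm x < Y / 2} \<in> sets borel" "{x::'a. 2 * Y < norm x} \<in> sets borel"
      by measurable
    then show "S1 \<in> sets W" "S2 \<in> sets W" "S3 \<in> sets W"
      unfolding S1_def S2_def S3_def using *[THEN borel_W] by (simp_all only: sets.Int[OF S])
  qed
  have tri: "norm x \<le> norm (x - y) + Y" "Y \<le> norm (x - y) + norm x" for x
    unfolding Y_def using norm_triangle_sub[of x y] norm_triangle_sub[of y x]
      norm_minus_commute[of x y] by linarith+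
  have b0: "0 < b" and bd: "0 < b * d" using b d by auto

  have I1: "(\<integral>\<^sup>+x. h x * indicator S1 x \<partial>W) \<le> ennreal (4 powr (b * d) * r powr d * D)"
  proof -
    have "(\<integral>\<^sup>+x. h x * indicator S1 x \<partial>W)
        \<le> ennreal ((Y / 2) powr - (b * d)) * ennreal (D * (r * (2 * Y) powr b) powr d)"
    proof (rule nn_integral_le_cmult_emeasure)
      show "ball y (r * (2 * Y) powr b) \<in> sets W"
        by (intro borel_W) simp
      show "emeasure W (ball y (r * (2 * Y) powr b)) \<le> ennreal (D * (r * (2 * Y) powr b) powr d)"
        using r Y by (intro growth) simp
      show "h x * indicator S1 x \<le> ennreal ((Y / 2) powr - (b * d)) * indicator (ball y (r * (2 * Y) powr b)) x" for x
      proof (cases "x \<in> S1")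
        case True
        then have "Y / 2 \<le> norm x" "norm x \<le> 2 * Y" "norm (x - y) < r * norm x powr b"
          by (auto simp: S1_def S_def)
        moreover have "r * norm x powr b \<le> r * (2 * Y) powr b"
          using r b0 calculation by (intro mult_left_mono powr_mono2) auto
        ultimately have "x \<in> ball y (r * (2 * Y) powr b)"
          by (simp add: dist_norm norm_minus_commute)
        moreover have "h x \<le> ennreal ((Y / 2) powr - (b * d))"
          unfolding h_def using \<open>Y / 2 \<le> norm x\<close> Y bd by (intro ennreal_leI powr_mono2') auto
        ultimately show ?thesis
          by (simp add: indicator_def)
      qed simp
    qed
    also have "\<dots> = ennreal ((Y / 2) powr - (b * d) * (D * (r * (2 * Y) powr b) powr d))"
      using D by (simp add: ennreal_mult)
    \<comment> \<open>Writing \<open>2 * Y\<close> as \<open>4 * (Y / 2)\<close> lets the power of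
      \<open>Y / 2\<close> cancel against the bound for the weight, with
      \<open>4 powr (b * d)\<close> left over.\<close>
    also have "(r * (2 * Y) powr b) powr d = r powr d * (4 * (Y / 2)) powr (b * d)"
      using r Y by (simp add: powr_mult powr_powr)
    also have "(4 * (Y / 2)) powr (b * d) = 4 powr (b * d) * (Y / 2) powr (b * d)"
      using Y by (subst powr_mult) auto
    also have "(Y / 2) powr - (b * d) * (D * (r powr d * (4 powr (b * d) * (Y / 2) powr (b * d))))
        = 4 powr (b * d) * r powr d * D * ((Y / 2) powr - (b * d) * (Y / 2) powr (b * d))"
      by (simp only: mult_ac)
    also have "(Y / 2) powr - (b * d) * (Y / 2) powr (b * d) = 1"
      using Y by (simp flip: powr_add)
    finally show ?thesis by simp
  qed

  have I2: "(\<integral>\<^sup>+x. h x * indicator S2 x \<partial>W) \<le> ennreal (4 powr d * r powr d * D)"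
  proof -
    have "(\<integral>\<^sup>+x. h x * indicator S2 x \<partial>W)
        \<le> ennreal ((2 * r / Y) powr d) * ennreal (D * (2 * Y) powr d)"
    proof (rule nn_integral_le_cmult_emeasure)
      show "ball y (2 * Y) \<in> sets W"
        by (intro borel_W) simp
      show "emeasure W (ball y (2 * Y)) \<le> ennreal (D * (2 * Y) powr d)"
        using Y by (intro growth) simp
      show "h x * indicator S2 x \<le> ennreal ((2 * r / Y) powr d) * indicator (ball y (2 * Y)) x" for x
      proof (cases "x \<in> S2")
        case True
        then have x: "0 < norm x" "norm x < Y / 2" "norm (x - y) < r * norm x powr b"
          by (auto simp: S2_def S_def)
        have "norm (x - y) \<le> norm x + Y"
          unfolding Y_def by (rule norm_triangle_ineq4)
        then have "x \<in> ball y (2 * Y)"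
          using x Y by (simp add: dist_norm norm_minus_commute)
        \<comment> \<open>Membership in \<open>S\<close> keeps \<open>x\<close> away from the
          singularity of the weight: the distance to \<open>y\<close> exceeds \<open>Y / 2\<close>,
          so \<open>r * norm x powr b\<close> does too. The resulting factor
          \<open>(2 * r / Y) powr d\<close> cancels the \<open>Y\<close> in the measure of a ball of
          radius \<open>2 * Y\<close>.\<close>
        moreover have "Y / 2 < r * norm x powr b"
          using tri(2)[of x] x by linarith
        then have "norm x powr - b \<le> 2 * r / Y"
          using x Y r by (simp add: powr_minus field_simps)
        then have "(norm x powr - b) powr d \<le> (2 * r / Y) powr d"
          using d by (intro powr_mono2) auto
        then have "h x \<le> ennreal ((2 * r / Y) powr d)"
          unfolding h_def by (intro ennreal_leI) (simp add: powr_powr)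
        ultimately show ?thesis
          by (simp add: indicator_def)
      qed simp
    qed
    also have "\<dots> = ennreal ((2 * r / Y) powr d * (D * (2 * Y) powr d))"
      using D by (simp add: ennreal_mult)
    also have "(2 * r / Y) powr d * (D * (2 * Y) powr d) = D * ((2 * r / Y) * (2 * Y)) powr d"
      using Y r by (subst powr_mult[of "2 * r / Y"]) auto
    also have "(2 * r / Y) * (2 * Y) = 4 * r"
      using Y by simp
    also have "D * (4 * r) powr d = 4 powr d * r powr d * D"
      using r by (simp add: powr_mult)
    finally show ?thesis .
  qed

  have I3: "(\<integral>\<^sup>+x. h x * indicator S3 x \<partial>W)
      \<le> ennreal (8 powr d / (1 - 2 powr - ((b - 1) * d)) * r powr d * D)"
  proof -
    \<comment> \<open>The solution of \<open>2 * r * \<rho> powr (b - 1) = 1\<close>, hence the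
      radius inside which no point of \<open>S3\<close> can lie.\<close>
    define \<rho> where "\<rho> = (2 * r) powr - (1 / (b - 1))"
    \<comment> \<open>The maximum with \<open>2 * Y\<close> ensures that, at every scale from
      \<open>P\<close> upwards, balls about \<open>y\<close> and about the origin are
      comparable.\<close>
    define P where "P = max \<rho> (2 * Y)"
    have \<rho>: "0 < \<rho>"
      using r by (simp add: \<rho>_def)
    have P: "0 < P" "\<rho> \<le> P" "2 * Y \<le> P"
      using \<rho> by (auto simp: P_def)
    have far: "P < norm x" if "x \<in> S3" for x
    proof -
      have x: "2 * Y < norm x" "norm (x - y) < r * norm x powr b"
        using that by (auto simp: S3_def S_def)
      then have x0: "0 < norm x"
        using Y by linarith
      have "norm x / 2 < r * norm x powr b"
        using tri(1)[of x] x by linarith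
      also have "norm x powr b = norm x powr (b - 1) * norm x"
        using x0 by (simp add: powr_diff)
      finally have "1 < (2 * r) * norm x powr (b - 1)"
        using x0 by (simp add: field_simps)
      then have "1 powr (1 / (b - 1)) < ((2 * r) * norm x powr (b - 1)) powr (1 / (b - 1))"
        using b by (intro powr_less_mono2) auto
      also have "\<dots> = (2 * r) powr (1 / (b - 1)) * norm x"
        using b r x0 by (subst powr_mult) (auto simp: powr_powr)
      finally have "\<rho> < norm x"
        using r by (simp add: \<rho>_def powr_minus field_simps)
      then show ?thesis
        using x by (simp add: P_def)
    qed
    define e where "e = (b - 1) * d"
    have e: "0 < e"
      using b d by (simp add: e_def)
    have two: "(2::real) powr - e < 1"
      using e powr_less_cancel_iff[of 2 "- e" 0] by simp
    have "(\<integral>\<^sup>+x. h x * indicator S3 x \<partial>W)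
        \<le> (\<Sum>k. ennreal ((2 ^ k * P) powr - (b * d)) * emeasure W (ball y (4 * (2 ^ k * P))))"
    proof (rule nn_integral_le_suminf_cover)
      fix x assume "h x * indicator S3 x \<noteq> 0"
      then have "x \<in> S3"
        by (auto split: split_indicator_asm)
      then obtain k where k: "2 ^ k * P < norm x" "norm x \<le> 2 ^ Suc k * P"
        using dyadic_scale[OF P(1) far] by blast
      \<comment> \<open>On the shell of scale \<open>2 ^ k * P\<close> the distance to
        \<open>y\<close> is at most \<open>2 * (2 ^ k * P) + Y\<close>, and \<open>Y\<close> is at
        most half of \<open>2 ^ k * P\<close>; hence radius \<open>4 * (2 ^ k * P)\<close>
        suffices.\<close>
      have "P \<le> 2 ^ k * P"
        using mult_right_mono[of 1 "2 ^ k" P] P(1) by simp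
      moreover have "2 ^ Suc k * P = 2 * (2 ^ k * P)"
        by simp
      moreover have "norm (x - y) \<le> norm x + Y"
        unfolding Y_def by (rule norm_triangle_ineq4)
      ultimately have "norm (x - y) < 4 * (2 ^ k * P)"
        using k P Y by linarith
      moreover have "h x \<le> ennreal ((2 ^ k * P) powr - (b * d))"
        unfolding h_def using k P bd by (intro ennreal_leI powr_mono2') auto
      ultimately show "\<exists>k. x \<in> ball y (4 * (2 ^ k * P)) \<and> h x * indicator S3 x \<le> ennreal ((2 ^ k * P) powr - (b * d))"
        using \<open>x \<in> S3\<close> by (intro exI[of _ k]) (simp add: dist_norm norm_minus_commute)
    qed (intro borel_W, simp)
    also have "\<dots> \<le> (\<Sum>k. ennreal (4 powr d * P powr - e * D * (2 powr - e) ^ k))"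
    proof (rule suminf_le)
      fix k
      have "ennreal ((2 ^ k * P) powr - (b * d)) * emeasure W (ball y (4 * (2 ^ k * P)))
          \<le> ennreal ((2 ^ k * P) powr - (b * d)) * ennreal (D * (4 * (2 ^ k * P)) powr d)"
        using P by (intro mult_left_mono growth) auto
      also have "\<dots> = ennreal ((2 ^ k * P) powr - (b * d) * (D * (4 * (2 ^ k * P)) powr d))"
        using D by (simp add: ennreal_mult)
      also have "(4 * (2 ^ k * P)) powr d = 4 powr d * (2 ^ k * P) powr d"
        using P by (subst powr_mult) auto
      \<comment> \<open>The decay \<open>- (b * d)\<close> of the weight beats the growth
        \<open>d\<close> of the balls by \<open>e = (b - 1) * d > 0\<close>, which makes the series
        over the shells converge.\<close>
      also have "(2 ^ k * P) powr - (b * d) * (D * (4 powr d * (2 ^ k * P) powr d))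
          = 4 powr d * D * (2 ^ k * P) powr - e"
        using P by (simp add: e_def algebra_simps flip: powr_add)
      also have "(2 ^ k * P) powr - e = (2 powr - e) ^ k * P powr - e"
        using P by (simp add: powr_mult two_power_powr)
      finally show "ennreal ((2 ^ k * P) powr - (b * d)) * emeasure W (ball y (4 * (2 ^ k * P)))
          \<le> ennreal (4 powr d * P powr - e * D * (2 powr - e) ^ k)"
        by (simp only: mult_ac)
    qed auto
    also have "\<dots> = ennreal (4 powr d * P powr - e * D / (1 - 2 powr - e))"
      using two D by (intro suminf_ennreal_geometric) auto
    also have "\<dots> \<le> ennreal (4 powr d * (2 * r) powr d * D / (1 - 2 powr - e))"
    proof -
      \<comment> \<open>Only \<open>P \<ge> \<rho>\<close> is kept here; the choice of
        \<open>\<rho>\<close> turns \<open>\<rho> powr - e\<close> into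
        \<open>(2 * r) powr d\<close>, so the bound no longer depends on \<open>Y\<close>.\<close>
      have "P powr - e \<le> \<rho> powr - e"
        using P \<rho> e by (intro powr_mono2') auto
      also have "\<dots> = (2 * r) powr d"
        using b by (simp add: \<rho>_def e_def powr_powr)
      finally show ?thesis
        using two D by (intro ennreal_leI divide_right_mono mult_right_mono mult_left_mono) auto
    qed
    also have "4 powr d * (2 * r) powr d * D / (1 - 2 powr - e)
        = 8 powr d / (1 - 2 powr - ((b - 1) * d)) * r powr d * D"
      using r by (simp add: e_def powr_mult[symmetric])
    finally show ?thesis .
  qed

  have "(\<integral>\<^sup>+x. h x * indicator S x \<partial>W)
      \<le> (\<integral>\<^sup>+x. h x * indicator S1 x + (h x * indicator S2 x + h x * indicator S3 x) \<partial>W)"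
    by (intro nn_integral_mono) (auto simp: S1_def S2_def S3_def h_def split: split_indicator)
  also have "\<dots> = (\<integral>\<^sup>+x. h x * indicator S1 x \<partial>W)
      + ((\<integral>\<^sup>+x. h x * indicator S2 x \<partial>W) + (\<integral>\<^sup>+x. h x * indicator S3 x \<partial>W))"
    by (simp add: nn_integral_add)
  also have "\<dots> \<le> ennreal (4 powr (b * d) * r powr d * D) + (ennreal (4 powr d * r powr d * D)
      + ennreal (8 powr d / (1 - 2 powr - ((b - 1) * d)) * r powr d * D))"
    by (intro add_mono I1 I2 I3)
  also have "\<dots> = ennreal ((4 powr (b * d) + 4 powr d + 8 powr d / (1 - 2 powr - ((b - 1) * d))) * r powr d * D)"
  proof -
    have "(2::real) powr - ((b - 1) * d) < 1"
      using b d powr_less_cancel_iff[of 2 "- ((b - 1) * d)" 0] by simp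
    then show ?thesis
      using D by (simp add: algebra_simps flip: ennreal_plus)
  qed
  finally show ?thesis
    by (simp add: h_def S_def)
qed

section \<open>Growth on balls of an \<open>A1\<close> weight\<close>

text \<open>The essential infimum is a supremum over possibly uncountably many lower bounds, each
  with its own null set. In \<open>ennreal\<close> it is also the supremum of a sequence of them, so
  countably many null sets suffice.\<close>

lemma AE_essinf_on_le: "AE x in lebesgue. x \<in> Q \<longrightarrow> essinf_on Q w \<le> ennreal (w x)"
proof -
  define A where "A = {c. AE x in lebesgue. x \<in> Q \<longrightarrow> c \<le> ennreal (w x)}"
  have "0 \<in> A"
    by (simp add: A_def)
  then obtain c :: "nat \<Rightarrow> ennreal" where c: "range c \<subseteq> A" "Sup A = (SUP i. c i)"
    using ennreal_Sup_countable_SUP[of A] by blast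
  have "AE x in lebesgue. \<forall>i. x \<in> Q \<longrightarrow> c i \<le> ennreal (w x)"
    unfolding AE_all_countable using c(1) by (auto simp: A_def)
  then show ?thesis
    unfolding essinf_on_def A_def[symmetric] c(2)
    by eventually_elim (auto intro: SUP_least)
qed

lemma emeasure_lebesgue_cube:
  fixes a :: "real^'n"
  assumes "0 < l"
  shows "emeasure lebesgue (cbox a (\<chi> i. a $ i + l)) = ennreal (l ^ CARD('n))"
proof -
  have "cbox a (\<chi> i. a $ i + l) \<noteq> {}"
    using assms by (auto simp: interval_eq_empty_cart not_less intro: less_imp_le)
  then have "measure lborel (cbox a (\<chi> i. a $ i + l)) = l ^ CARD('n)"
    by (simp add: content_cbox_cart)
  moreover have "emeasure lborel (cbox a (\<chi> i. a $ i + l))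
      = ennreal (measure lborel (cbox a (\<chi> i. a $ i + l)))"
    using emeasure_lborel_cbox_finite[of a "\<chi> i. a $ i + l"]
    by (intro emeasure_eq_ennreal_measure) (simp add: less_top)
  ultimately show ?thesis
    by simp
qed

text \<open>The exceptional null set has to serve all radii at once. It is therefore built from
  countably many cubes, those with corner in a countable dense set and rational side, and every ball
  is enclosed in one of them of comparable size.\<close>

lemma A1_ball_bound:
  fixes u :: "real^'n \<Rightarrow> real"
  assumes "A1 u"
  obtains B where "0 < B"
    "AE y in lebesgue. \<forall>R>0. wmeasure u (ball y R) \<le> ennreal (B * R powr CARD('n) * u y)"
proof -
  obtain C where C: "\<And>Q. cube Q \<Longrightarrow>
      wmeasure u Q / emeasure lebesgue Q \<le> ennreal C * essinf_on Q u"
    and pos: "AE y in lebesgue. 0 < u y"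
    using assms by (auto simp: A1_def weight_def)
  \<comment> \<open>The maximum makes the constant positive, since \<open>C\<close> is an arbitrary
    real; \<open>5 ^ CARD('n)\<close> comes from a cube of side less than
    \<open>5 * R\<close>.\<close>
  define B where "B = max C 1 * 5 ^ CARD('n)"
  have B: "0 < B"
    by (simp add: B_def)
  obtain D :: "(real^'n) set" where D: "countable D"
    "\<And>X. open X \<Longrightarrow> X \<noteq> {} \<Longrightarrow> \<exists>d\<in>D. d \<in> X"
    using countable_dense_exists by blast
  define Q where "Q a l = cbox a (\<chi> i. a $ i + l)" for a :: "real^'n" and l :: real
  have "AE y in lebesgue. \<forall>p \<in> D \<times> \<rat>. y \<in> Q (fst p) (snd p)
      \<longrightarrow> essinf_on (Q (fst p) (snd p)) u \<le> ennreal (u y)"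
    using D countable_rat by (intro AE_ball_countable' AE_essinf_on_le) auto
  with pos have "AE y in lebesgue. \<forall>R>0. wmeasure u (ball y R) \<le> ennreal (B * R powr CARD('n) * u y)"
  proof eventually_elim
    case (elim y)
    show ?case
    proof (intro allI impI)
      fix R :: real assume R: "0 < R"
      \<comment> \<open>The ideal corner is \<open>y - l / 2\<close> in each coordinate. Moving the
        corner by less than \<open>R\<close> and passing from \<open>y\<close> to a point of the
        ball costs less than \<open>2 * R\<close> per coordinate, which \<open>l / 2 > 2 * R\<close>
        absorbs on both sides.\<close>
      obtain l where l: "l \<in> \<rat>" "4 * R < l" "l < 5 * R"
        using Rats_dense_in_real[of "4 * R" "5 * R"] R by auto
      have l0: "0 < l"
        using l R by simp
      obtain a where a: "a \<in> D" "a \<in> ball (\<chi> i. y $ i - l / 2) R"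
        using D(2)[of "ball (\<chi> i. y $ i - l / 2) R"] R by auto
      have ai: "\<bar>(y $ i - l / 2) - a $ i\<bar> < R" for i
        using a(2) component_le_norm_cart[of "(\<chi> i. y $ i - l / 2) - a" i]
        by (simp add: dist_norm)
      have sub: "ball y R \<subseteq> Q a l"
      proof
        fix x assume "x \<in> ball y R"
        then have xi: "\<bar>y $ i - x $ i\<bar> < R" for i
          using component_le_norm_cart[of "y - x" i] by (simp add: dist_norm)
        show "x \<in> Q a l"
          unfolding Q_def mem_box_cart
        proof
          fix i
          show "a $ i \<le> x $ i \<and> x $ i \<le> (\<chi> i. a $ i + l) $ i"
            using ai[of i] xi[of i] l(2) by (auto simp: abs_less_iff)
        qed
      qed
      have "y \<in> Q a l"
        using sub R by auto
      then have ess: "essinf_on (Q a l) u \<le> ennreal (u y)"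
        using elim(2) a l by auto
      have mQ: "emeasure lebesgue (Q a l) = ennreal (l ^ CARD('n))"
        unfolding Q_def using l0 by (rule emeasure_lebesgue_cube)
      have "wmeasure u (ball y R) \<le> wmeasure u (Q a l)"
        unfolding wmeasure_def using sub
        by (intro nn_integral_mono) (auto split: split_indicator)
      also have "\<dots> = wmeasure u (Q a l) / emeasure lebesgue (Q a l) * ennreal (l ^ CARD('n))"
        using l0 by (simp add: mQ ennreal_divide_times mult_divide_eq_ennreal)
      also have "\<dots> \<le> ennreal C * essinf_on (Q a l) u * ennreal (l ^ CARD('n))"
        using l0 by (intro mult_right_mono C) (auto simp: cube_def Q_def)
      also have "\<dots> \<le> ennreal (max C 1) * ennreal (u y) * ennreal (l ^ CARD('n))"
        by (intro mult_right_mono mult_mono ess ennreal_leI) auto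
      also have "\<dots> = ennreal (max C 1 * u y * l ^ CARD('n))"
        using elim(1) l0 by (simp add: ennreal_mult)
      also have "\<dots> \<le> ennreal (max C 1 * u y * (5 * R) ^ CARD('n))"
        using elim(1) l0 l by (intro ennreal_leI mult_left_mono power_mono) auto
      also have "max C 1 * u y * (5 * R) ^ CARD('n) = B * R powr CARD('n) * u y"
        using R by (simp add: B_def power_mult_distrib powr_realpow)
      finally show "wmeasure u (ball y R) \<le> ennreal (B * R powr CARD('n) * u y)" .
    qed
  qed
  with B show ?thesis
    by (rule that)
qed

section \<open>Measurability, finiteness and passage to absolute integrals\<close>

lemma locally_integrable_borel_measurable:
  assumes "locally_integrable w"
  shows "w \<in> borel_measurable lebesgue"
proof (rule borel_measurable_LIMSEQ_real)
  show "(\<lambda>x. indicator (cball 0 (real N)) x * w x) \<in> borel_measurable lebesgue" for N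
    using assms by (auto simp: locally_integrable_def set_integrable_def
        dest!: spec[of _ "cball 0 (real N)"] borel_measurable_integrable)
  show "(\<lambda>N. indicator (cball 0 (real N)) x * w x) \<longlonglongrightarrow> w x" for x
  proof (rule tendsto_eventually)
    obtain N0 where N0: "norm x \<le> real N0"
      using real_arch_simple by blast
    show "\<forall>\<^sub>F N in sequentially. indicator (cball 0 (real N)) x * w x = w x"
      using eventually_ge_at_top[of N0]
    proof eventually_elim
      case (elim N)
      then have "norm x \<le> real N" using N0 by linarith
      then show ?case by simp
    qed
  qed
qed

lemma wmeasure_bounded_finite:
  assumes "locally_integrable w" "bounded S"
  shows "wmeasure w S < \<infinity>"
proof -
  obtain R where R: "S \<subseteq> cball 0 R"
    using assms(2) by (auto simp: bounded_iff subset_iff)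
  have "wmeasure w S \<le> (\<integral>\<^sup>+x. ennreal (norm (indicator (cball 0 R) x *\<^sub>R w x)) \<partial>lebesgue)"
    unfolding wmeasure_def using R
    by (intro nn_integral_mono) (auto split: split_indicator intro: ennreal_leI)
  also have "\<dots> < \<infinity>"
    using assms(1) by (auto simp: locally_integrable_def set_integrable_def integrable_iff_bounded)
  finally show ?thesis .
qed

lemma sigma_finite_lebesgue: "sigma_finite_measure (lebesgue :: 'a::euclidean_space measure)"
proof
  show "\<exists>A::'a set set. countable A \<and> A \<subseteq> sets lebesgue \<and> \<Union> A = space lebesgue
      \<and> (\<forall>a\<in>A. emeasure lebesgue a \<noteq> \<infinity>)"
  proof (intro exI[of _ "range (\<lambda>N::nat. ball 0 (real N))"] conjI)
    show "\<Union> (range (\<lambda>N::nat. ball (0::'a) (real N))) = space lebesgue"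
      using reals_Archimedean2 by auto
    show "\<forall>a\<in>range (\<lambda>N::nat. ball (0::'a) (real N)). emeasure lebesgue a \<noteq> \<infinity>"
      using emeasure_lborel_ball_finite by (auto simp: less_top)
  qed auto
qed

lemma ennpowr_le:
  assumes "a \<le> ennreal (x powr p)" "0 < p" "0 \<le> x"
  shows "ennpowr a (1 / p) \<le> ennreal x"
proof -
  have "a < \<infinity>"
    using assms(1) by (simp add: le_less_trans)
  then obtain a' where a': "a = ennreal a'" "0 \<le> a'"
    by (cases a) auto
  then have "a' \<le> x powr p"
    using assms by simp
  then have "a' powr (1 / p) \<le> (x powr p) powr (1 / p)"
    using a' assms by (intro powr_mono2) auto
  then show ?thesis
    using a' assms by (simp add: ennpowr_def powr_powr ennreal_leI)
qed

text \<open>Where the integrand is not integrable, the value of the Bochner integral is 0 and the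
  bound is trivial. Convergence of the fractional integral thus never has to be discussed
  afterwards.\<close>

lemma frac_integral_le_nn_integral:
  "ennreal \<bar>frac_integral \<gamma> g x\<bar>
    \<le> (\<integral>\<^sup>+y. ennreal (\<bar>g y\<bar> * norm (x - y) powr - (real CARD('n) - \<gamma>)) \<partial>lebesgue)"
  for g :: "real^'n \<Rightarrow> real"
proof (cases "integrable lebesgue (\<lambda>y. g y / norm (x - y) powr (real CARD('n) - \<gamma>))")
  case True
  from integral_norm_bound_ennreal[OF this] show ?thesis
    unfolding frac_integral_def powr_minus by (simp add: abs_mult divide_inverse)
next
  case False
  then show ?thesis
    by (simp add: frac_integral_def not_integrable_integral_eq)
qed

section \<open>The weak-type inequality for the fractional integral\<close>

theorem theorem8:
  fixes u v :: "real^'n \<Rightarrow> real" and \<gamma> \<beta> q :: real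
  assumes "0 < \<gamma>" and "\<gamma> < real CARD('n)"
    and "A1 u"
    and "\<beta> < - real CARD('n)"
    and "v = (\<lambda>x. norm x powr \<beta>)"
    and "q = real CARD('n) / (real CARD('n) - \<gamma>)"
  shows "\<exists>C::real. 0 < C \<and>
    (\<forall>t::real. \<forall>f::real^'n \<Rightarrow> real.
       0 < t \<longrightarrow> f \<in> borel_measurable lebesgue \<longrightarrow> bounded (range f) \<longrightarrow>
       ennpowr (wmeasure (\<lambda>x. u x * v x powr q)
                  {x. \<bar>frac_integral \<gamma> (\<lambda>y. f y * v y) x\<bar> / v x > t}) (1 / q)
       \<le> ennreal (C / t) * (\<integral>\<^sup>+x. ennreal (\<bar>f x\<bar> * u x powr (1 / q) * v x) \<partial>lebesgue))"
proof -
  define d where "d = real CARD('n)"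
  define \<alpha> where "\<alpha> = d - \<gamma>"
  define b where "b = - \<beta> / \<alpha>"
  have \<alpha>: "0 < \<alpha>" "\<alpha> < d"
    using assms(1,2) by (auto simp: \<alpha>_def d_def)
  have d: "0 < d"
    using \<alpha> by simp
  have \<beta>: "\<beta> < - d"
    using assms(4) by (simp add: d_def)
  have b: "1 < b"
    using \<alpha> \<beta> by (simp add: b_def field_simps)
  have q: "q = d / \<alpha>" "1 < q"
    using assms(6) \<alpha> by (simp_all add: d_def \<alpha>_def)
  have v: "v x = norm x powr \<beta>" for x
    using assms(5) by simp
  have vq: "v x powr q = norm x powr - (b * d)" for x
    using \<alpha> by (simp add: v powr_powr b_def q)
  have u_li: "locally_integrable u" and u_pos: "AE x in lebesgue. 0 < u x"
    using assms(3) by (auto simp: A1_def weight_def)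
  have [measurable]: "u \<in> borel_measurable lebesgue"
    using u_li by (rule locally_integrable_borel_measurable)
  have [measurable]: "(\<lambda>x. x) \<in> borel_measurable (lebesgue :: (real^'n) measure)"
    by (simp add: measurable_completion)
  obtain B where B: "0 < B"
    "AE y in lebesgue. \<forall>R>0. wmeasure u (ball y R) \<le> ennreal (B * R powr d * u y)"
    using A1_ball_bound[OF assms(3)] unfolding d_def by blast

  define W where "W = density lebesgue (\<lambda>x. ennreal (u x))"
  \<comment> \<open>The division by \<open>v x\<close> is absorbed into the kernel, so that the
    quotient in the level set is dominated by the integral of \<open>\<bar>f y\<bar> * v y\<close>
    against \<open>K x y\<close>.\<close>
  define K where "K x y = norm (x - y) powr - \<alpha> * norm x powr - \<beta>" for x y :: "real^'n"
  define \<mu> where "\<mu> = density lebesgue (\<lambda>x. ennreal (u x * v x powr q))"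
  define A where "A = (4 powr (b * d) + 4 powr d + 8 powr d / (1 - 2 powr - ((b - 1) * d))) * B"
  have "(2::real) powr - ((b - 1) * d) < 1"
    using b d powr_less_cancel_iff[of 2 "- ((b - 1) * d)" 0] by simp
  then have A: "0 \<le> A"
    using B(1) by (simp add: A_def)

  have [measurable]: "{x. s < K x y} \<in> sets lebesgue" for s y
  proof -
    have "{x. s < K x y} \<in> sets borel"
      unfolding K_def by measurable
    then show ?thesis
      by simp
  qed
  have K_weak: "AE y in lebesgue. \<forall>s>0. emeasure \<mu> {x. s < K x y} \<le> ennreal (A * s powr - q * u y)"
  proof -
    have "AE y in lebesgue. y \<noteq> (0 :: real^'n)"
      by (rule AE_completion) (rule AE_lborel_singleton)
    with u_pos B(2) show ?thesis
    proof eventually_elim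
      case (elim y)
      show ?case
      proof (intro allI impI)
        fix s :: real assume s: "0 < s"
        define r where "r = s powr - (1 / \<alpha>)"
        define S where "S = {x. norm (x - y) < r * norm x powr b}"
        have sub: "x \<in> S" if "s < K x y" for x
        proof -
          \<comment> \<open>Since \<open>0 powr p = 0\<close>, the kernel vanishes for
            \<open>x = y\<close> and for \<open>x = 0\<close>, so neither case is compatible with
            \<open>0 < s < K x y\<close>.\<close>
          have x: "0 < norm (x - y)" "0 < norm x"
            using that s by (auto simp: K_def intro: ccontr)
          have "norm (x - y) powr \<alpha> < norm x powr - \<beta> / s"
            using that s x by (simp add: K_def powr_minus[of _ \<alpha>] field_simps)
          then have "(norm (x - y) powr \<alpha>) powr (1 / \<alpha>) < (norm x powr - \<beta> / s) powr (1 / \<alpha>)"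
            using \<alpha> by (intro powr_less_mono2) auto
          also have "\<dots> = (norm x powr - \<beta>) powr (1 / \<alpha>) / s powr (1 / \<alpha>)"
            by (rule powr_divide)
          also have "\<dots> = r * norm x powr b"
            by (simp add: powr_powr r_def b_def powr_minus_divide[of s])
          finally show "x \<in> S"
            using \<alpha> by (simp add: S_def powr_powr)
        qed
        have "S \<in> sets borel"
          unfolding S_def by measurable
        then have [measurable]: "S \<in> sets lebesgue"
          by simp
        \<comment> \<open>The \<open>A1\<close> bound at \<open>y\<close> is the growth condition
          with constant \<open>B * u y\<close>; this is where the factor \<open>u y\<close> of the
          point-mass estimate comes from.\<close>
        have growth: "emeasure W (ball y R) \<le> ennreal (B * u y * R powr d)" if "0 < R" for R
          using elim that by (simp add: W_def emeasure_density wmeasure_def mult_ac)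
        have "emeasure \<mu> {x. s < K x y}
            = (\<integral>\<^sup>+x. ennreal (u x * v x powr q) * indicator {x. s < K x y} x \<partial>lebesgue)"
          unfolding \<mu>_def vq by (rule emeasure_density) measurable
        also have "\<dots> \<le> (\<integral>\<^sup>+x. ennreal (u x) * (ennreal (norm x powr - (b * d)) * indicator S x) \<partial>lebesgue)"
          using sub by (intro nn_integral_mono) (auto simp: vq ennreal_mult'' split: split_indicator)
        also have "\<dots> = (\<integral>\<^sup>+x. ennreal (norm x powr - (b * d)) * indicator S x \<partial>W)"
          unfolding W_def by (rule nn_integral_density[symmetric]) measurable
        also have "\<dots> \<le> ennreal ((4 powr (b * d) + 4 powr d + 8 powr d / (1 - 2 powr - ((b - 1) * d)))
            * r powr d * (B * u y))"
          unfolding S_def using elim b d B(1) s growth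
          by (intro set_nn_integral_power_weight_le) (auto simp: W_def r_def)
        also have "r powr d = s powr - q"
          by (simp add: r_def powr_powr q)
        finally show "emeasure \<mu> {x. s < K x y} \<le> ennreal (A * s powr - q * u y)"
          by (simp add: A_def mult_ac)
      qed
    qed
  qed

  define c where "c = 1 + 2 * A / (1 - 2 powr (1 - q))"
  have "(2::real) powr (1 - q) < 1"
    using q powr_less_cancel_iff[of 2 "1 - q" 0] by simp
  then have c: "0 < c"
    using A by (simp add: c_def add_pos_nonneg)
  show ?thesis
  proof (intro exI[of _ c] conjI allI impI c)
    fix t :: real and f :: "real^'n \<Rightarrow> real"
    assume t: "0 < t" and f[measurable]: "f \<in> borel_measurable lebesgue"
    define E where "E = {x. \<bar>frac_integral \<gamma> (\<lambda>y. f y * v y) x\<bar> / v x > t}"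
    define J where "J = (\<integral>\<^sup>+x. ennreal (\<bar>f x\<bar> * u x powr (1 / q) * v x) \<partial>lebesgue)"
    show "ennpowr (wmeasure (\<lambda>x. u x * v x powr q) E) (1 / q) \<le> ennreal (c / t) * J"
    proof (cases "J = \<infinity>")
      case True
      then show ?thesis
        using c t by (simp add: ennreal_mult_top)
    next
      case False
      then obtain I where I: "J = ennreal I" "0 \<le> I"
        by (cases J) auto
      define g where "g y = ennreal (\<bar>f y\<bar> * v y)" for y
      have [measurable]: "g \<in> borel_measurable lebesgue"
        unfolding g_def v by measurable
      define F where "F = {x. ennreal t < (\<integral>\<^sup>+y. g y * ennreal (K x y) \<partial>lebesgue)}"
      \<comment> \<open>These annuli exhaust the complement of the origin. On each one
        \<open>v x powr q\<close> is bounded and \<open>u\<close> is integrable, so the restricted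
        measure \<open>\<mu>' N\<close> is finite, as the operator bound requires. The bound
        obtained does not depend on \<open>N\<close>.\<close>
      define R where "R N = {x :: real^'n. 1 / real (Suc N) \<le> norm x \<and> norm x \<le> real (Suc N)}" for N
      have "R N \<in> sets borel" for N
        unfolding R_def by measurable
      then have [measurable]: "R N \<in> sets lebesgue" for N
        by simp
      define \<mu>' where "\<mu>' N = density lebesgue (\<lambda>x. ennreal (u x * v x powr q) * indicator (R N) x)" for N
      have space_\<mu>': "space (\<mu>' N) = UNIV" for N
        by (simp add: \<mu>'_def)
      have finite_\<mu>': "finite_measure (\<mu>' N)" for N
      proof
        have "emeasure (\<mu>' N) (space (\<mu>' N))
            = (\<integral>\<^sup>+x. ennreal (u x * v x powr q) * indicator (R N) x \<partial>lebesgue)"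
          unfolding \<mu>'_def vq by (subst emeasure_density) auto
        also have "\<dots> \<le> (\<integral>\<^sup>+x. ennreal ((1 / real (Suc N)) powr - (b * d))
            * (ennreal (u x) * indicator (R N) x) \<partial>lebesgue)"
        proof (rule nn_integral_mono)
          fix x
          have "ennreal (v x powr q) \<le> ennreal ((1 / real (Suc N)) powr - (b * d))" if "x \<in> R N"
            unfolding vq using that b d by (intro ennreal_leI powr_mono2') (auto simp: R_def)
          then have "ennreal (v x powr q) * ennreal (u x) \<le> ennreal ((1 / real (Suc N)) powr - (b * d)) * ennreal (u x)" if "x \<in> R N"
            using that by (intro mult_right_mono) auto
          then show "ennreal (u x * v x powr q) * indicator (R N) x
              \<le> ennreal ((1 / real (Suc N)) powr - (b * d)) * (ennreal (u x) * indicator (R N) x)"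
            by (auto simp: ennreal_mult'' mult.commute split: split_indicator)
        qed
        also have "\<dots> = ennreal ((1 / real (Suc N)) powr - (b * d)) * wmeasure u (R N)"
          unfolding wmeasure_def by (rule nn_integral_cmult) measurable
        also have "\<dots> < \<infinity>"
        proof -
          have "bounded (R N)"
            by (auto simp: bounded_iff R_def)
          from wmeasure_bounded_finite[OF u_li this] show ?thesis
            by (simp add: ennreal_mult_less_top)
        qed
        finally show "emeasure (\<mu>' N) (space (\<mu>' N)) \<noteq> \<infinity>"
          by simp
      qed
      have bound: "emeasure (\<mu>' N) F \<le> ennreal ((c * I / t) powr q)" for N
      proof -
        \<comment> \<open>The kernel is a Borel expression in both variables, so it is enough that
          the projections from the product are measurable into the Borel sets.\<close>
        have id_N: "(\<lambda>x. x) \<in> measurable (\<mu>' N) borel"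
          unfolding \<mu>'_def by simp
        have [measurable]: "fst \<in> measurable (\<mu>' N \<Otimes>\<^sub>M lebesgue) borel"
          by (rule measurable_compose[OF measurable_fst id_N])
        have [measurable]: "snd \<in> measurable (\<mu>' N \<Otimes>\<^sub>M (lebesgue :: (real^'n) measure)) borel"
          by (rule measurable_compose[OF measurable_snd, of "\<lambda>x. x"]) measurable
        have "emeasure (\<mu>' N) {x\<in>space (\<mu>' N). ennreal t < (\<integral>\<^sup>+y. g y * ennreal (K x y) \<partial>lebesgue)}
            \<le> ennreal (((1 + 2 * A / (1 - 2 powr (1 - q))) * I / t) powr q)"
        proof (rule weak_type_integral_operator)
          show "finite_measure (\<mu>' N)" "sigma_finite_measure (lebesgue :: (real^'n) measure)"
            by (fact finite_\<mu>' sigma_finite_lebesgue)+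
          show "(\<lambda>(x, y). K x y) \<in> borel_measurable (\<mu>' N \<Otimes>\<^sub>M lebesgue)"
            unfolding K_def split_beta by measurable
          show "AE y in lebesgue. \<forall>s>0. emeasure (\<mu>' N) {x \<in> space (\<mu>' N). s < K x y}
              \<le> ennreal (A * s powr - q * u y)"
            using K_weak
          proof eventually_elim
            case (elim y)
            have "emeasure (\<mu>' N) {x. s < K x y} \<le> emeasure \<mu> {x. s < K x y}" for s
            proof -
              show ?thesis
                unfolding \<mu>_def \<mu>'_def vq
                by (subst (1 2) emeasure_density) (auto intro!: nn_integral_mono split: split_indicator)
            qed
            then show ?case
              using elim by (auto simp: space_\<mu>' intro: order_trans)
          qed
          show "(\<integral>\<^sup>+y. g y * ennreal (u y powr (1 / q)) \<partial>lebesgue) = ennreal I"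
            unfolding I(1)[symmetric] J_def
            by (intro nn_integral_cong) (simp add: g_def v mult_ac flip: ennreal_mult)
        qed (use q A t I u_pos in auto)
        then show ?thesis
          by (simp add: F_def c_def space_\<mu>')
      qed
      have [measurable]: "F \<in> sets lebesgue"
      proof -
        interpret sigma_finite_measure "lebesgue :: (real^'n) measure"
          by (rule sigma_finite_lebesgue)
        have [measurable]: "fst \<in> measurable ((lebesgue :: (real^'n) measure) \<Otimes>\<^sub>M (lebesgue :: (real^'n) measure)) borel"
          by (rule measurable_compose[OF measurable_fst, of "\<lambda>x. x"]) measurable
        have [measurable]: "snd \<in> measurable ((lebesgue :: (real^'n) measure) \<Otimes>\<^sub>M (lebesgue :: (real^'n) measure)) borel"
          by (rule measurable_compose[OF measurable_snd, of "\<lambda>x. x"]) measurable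
        have [measurable]: "(\<lambda>(x, y). K x y) \<in> borel_measurable (lebesgue \<Otimes>\<^sub>M lebesgue)"
          unfolding K_def split_beta by measurable
        have "{x \<in> space lebesgue. ennreal t < (\<integral>\<^sup>+y. g y * ennreal (K x y) \<partial>lebesgue)} \<in> sets lebesgue"
          by measurable
        then show ?thesis
          by (simp add: F_def)
      qed
      have E_F: "x \<in> F \<and> x \<noteq> 0" if "x \<in> E" for x
      proof -
        define a where "a = \<bar>frac_integral \<gamma> (\<lambda>y. f y * v y) x\<bar>"
        have x: "t < a / v x"
          using that by (simp add: E_def a_def)
        \<comment> \<open>At the origin \<open>v\<close> is 0 and division by 0 gives 0, so the
          origin does not belong to \<open>E\<close>.\<close>
        then have x0: "x \<noteq> 0"
          using t by (auto simp: v)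
        have "ennreal t < ennreal (a / v x)"
          using x t by (simp add: ennreal_less_iff)
        also have "\<dots> = ennreal (norm x powr - \<beta>) * ennreal a"
          by (simp add: a_def v powr_minus divide_inverse mult.commute flip: ennreal_mult)
        also have "\<dots> \<le> ennreal (norm x powr - \<beta>)
            * (\<integral>\<^sup>+y. ennreal (\<bar>f y * v y\<bar> * norm (x - y) powr - \<alpha>) \<partial>lebesgue)"
          unfolding a_def \<alpha>_def d_def by (intro mult_left_mono frac_integral_le_nn_integral) auto
        also have "\<dots> = (\<integral>\<^sup>+y. ennreal (norm x powr - \<beta>)
            * ennreal (\<bar>f y * v y\<bar> * norm (x - y) powr - \<alpha>) \<partial>lebesgue)"
          unfolding v by (rule nn_integral_cmult[symmetric]) measurable
        also have "\<dots> = (\<integral>\<^sup>+y. g y * ennreal (K x y) \<partial>lebesgue)"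
          by (intro nn_integral_cong) (simp add: g_def K_def v abs_mult mult_ac flip: ennreal_mult)
        finally show ?thesis
          using x0 by (simp add: F_def)
      qed
      \<comment> \<open>From here on \<open>E\<close> enters only through this inclusion:
        monotonicity of the integral then replaces it by measurable sets, and continuity from below
        passes to the limit in \<open>N\<close>.\<close>
      have "E \<subseteq> (\<Union>N. F \<inter> R N)"
      proof
        fix x assume "x \<in> E"
        then have x: "x \<in> F" "0 < norm x"
          using E_F by auto
        obtain N1 where N1: "norm x \<le> real N1"
          using real_arch_simple by blast
        obtain N2 where N2: "1 / norm x \<le> real N2"
          using real_arch_simple by blast
        have "1 / norm x \<le> real (Suc (max N1 N2))"
          using N2 by simp
        then have "1 / real (Suc (max N1 N2)) \<le> norm x"
          using x by (simp add: field_simps)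
        moreover have "norm x \<le> real (Suc (max N1 N2))"
          using N1 by simp
        ultimately show "x \<in> (\<Union>N. F \<inter> R N)"
          using x unfolding R_def by blast
      qed
      then have "wmeasure (\<lambda>x. u x * v x powr q) E
          \<le> (\<integral>\<^sup>+x. ennreal (u x * v x powr q) * indicator (\<Union>N. F \<inter> R N) x \<partial>lebesgue)"
        unfolding wmeasure_def by (intro nn_integral_mono) (auto split: split_indicator)
      also have "\<dots> = emeasure \<mu> (\<Union>N. F \<inter> R N)"
        unfolding \<mu>_def vq by (rule emeasure_density[symmetric]) measurable
      also have "\<dots> = (SUP N. emeasure \<mu> (F \<inter> R N))"
      proof (rule SUP_emeasure_incseq[symmetric])
        have "R M \<subseteq> R N" if "M \<le> N" for M N
        proof
          fix x assume "x \<in> R M"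
          moreover have "1 / real (Suc N) \<le> 1 / real (Suc M)"
            using that by (intro divide_left_mono) auto
          ultimately show "x \<in> R N"
            using that by (auto simp: R_def)
        qed
        then show "incseq (\<lambda>N. F \<inter> R N)"
          by (auto simp: incseq_def)
      qed (auto simp: \<mu>_def)
      also have "\<dots> = (SUP N. emeasure (\<mu>' N) F)"
      proof (rule SUP_cong[OF refl])
        fix N
        show "emeasure \<mu> (F \<inter> R N) = emeasure (\<mu>' N) F"
          unfolding \<mu>_def \<mu>'_def vq
          by (subst (1 2) emeasure_density) (auto intro!: nn_integral_cong split: split_indicator)
      qed
      also have "\<dots> \<le> ennreal ((c * I / t) powr q)"
        by (intro SUP_least bound)
      finally have "ennpowr (wmeasure (\<lambda>x. u x * v x powr q) E) (1 / q) \<le> ennreal (c * I / t)"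
        using q c I t by (intro ennpowr_le) auto
      also have "\<dots> = ennreal (c / t) * J"
        using c t I by (simp flip: ennreal_mult)
      finally show ?thesis .
    qed
  qed
qed

end
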